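(* Let $G$ be a compact group and $H\le G$ a closed subgroup of finite index. Then: - every free continuous $H$-action on a Tychonoff space is principal if and only if every free continuous $G$-action on a Tychonoff space is principal; - every free continuous $H$-action on a compact Hausdorff space is principal if and only if every free continuous $G$-action on a compact Hausdorff space is principal.
   Context: Compact groups are compact Hausdorff topological groups; Tychonoff spaces are completely regular Hausdorff spaces. A free continuous action of a compact group $K$ on a Tychonoff space $X$ is principal if $X\to X/K$ is a locally trivial principal $K$-bundle, i.e. every point of $X/K$ has an open neighborhood $U$ whose preimage in $X$ is $K$-equivariantly homeomorphic over $U$ to $K\times U$. *)

theory Defs
  imports "HOL-Analysis.Analysis" "HOL-Algebra.Group_Action"
begin

definition topological_group :: "('g, 'm) monoid_scheme \<Rightarrow> 'g topology \<Rightarrow> bool" where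
  "topological_group G T \<longleftrightarrow>
     group G \<and> topspace T = carrier G \<and>
     continuous_map (prod_topology T T) T (\<lambda>(g, h). g \<otimes>\<^bsub>G\<^esub> h) \<and>
     continuous_map T T (\<lambda>g. inv\<^bsub>G\<^esub> g)"

definition compact_group :: "('g, 'm) monoid_scheme \<Rightarrow> 'g topology \<Rightarrow> bool" where
  "compact_group G T \<longleftrightarrow>
     topological_group G T \<and> compact_space T \<and> Hausdorff_space T"

definition tychonoff_space :: "'x topology \<Rightarrow> bool" where
  "tychonoff_space X \<longleftrightarrow> completely_regular_space X \<and> Hausdorff_space X"

text \<open>Actions are left actions in the sense of \<^locale>\<open>group_action\<close>; continuity is joint
  continuity of the action map.\<close>

definition continuous_action ::
  "('g, 'm) monoid_scheme \<Rightarrow> 'g topology \<Rightarrow> 'x topology \<Rightarrow> ('g \<Rightarrow> 'x \<Rightarrow> 'x) \<Rightarrow> bool" where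
  "continuous_action G T X \<phi> \<longleftrightarrow>
     group_action G (topspace X) \<phi> \<and>
     continuous_map (prod_topology T X) X (\<lambda>(g, x). \<phi> g x)"

definition free_action ::
  "('g, 'm) monoid_scheme \<Rightarrow> 'x topology \<Rightarrow> ('g \<Rightarrow> 'x \<Rightarrow> 'x) \<Rightarrow> bool" where
  "free_action G X \<phi> \<longleftrightarrow> (\<forall>x\<in>topspace X. stabilizer G \<phi> x = {\<one>\<^bsub>G\<^esub>})"

definition free_continuous_action ::
  "('g, 'm) monoid_scheme \<Rightarrow> 'g topology \<Rightarrow> 'x topology \<Rightarrow> ('g \<Rightarrow> 'x \<Rightarrow> 'x) \<Rightarrow> bool" where
  "free_continuous_action G T X \<phi> \<longleftrightarrow> continuous_action G T X \<phi> \<and> free_action G X \<phi>"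

text \<open>The orbit space is the set of orbits with the quotient topology; the projection
  is \<^term>\<open>orbit G \<phi>\<close>, as \<open>quotient_map_orbit\<close> below confirms.\<close>

definition orbit_space ::
  "('g, 'm) monoid_scheme \<Rightarrow> 'x topology \<Rightarrow> ('g \<Rightarrow> 'x \<Rightarrow> 'x) \<Rightarrow> 'x set topology" where
  "orbit_space G X \<phi> =
     topology (\<lambda>U. U \<subseteq> orbits G (topspace X) \<phi> \<and>
                   openin X {x \<in> topspace X. orbit G \<phi> x \<in> U})"

lemma openin_orbit_space:
  "openin (orbit_space G X \<phi>) U \<longleftrightarrow>
     U \<subseteq> orbits G (topspace X) \<phi> \<and> openin X {x \<in> topspace X. orbit G \<phi> x \<in> U}"
proof -
  let ?L = "\<lambda>U. U \<subseteq> orbits G (topspace X) \<phi> \<and> openin X {x \<in> topspace X. orbit G \<phi> x \<in> U}"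
  have "istopology ?L"
    unfolding istopology_def
  proof (intro conjI allI impI)
    fix S T assume S: "?L S" and T: "?L T"
    show "S \<inter> T \<subseteq> orbits G (topspace X) \<phi>" using S by blast
    have "{x \<in> topspace X. orbit G \<phi> x \<in> S \<inter> T} =
          {x \<in> topspace X. orbit G \<phi> x \<in> S} \<inter> {x \<in> topspace X. orbit G \<phi> x \<in> T}" by blast
    then show "openin X {x \<in> topspace X. orbit G \<phi> x \<in> S \<inter> T}" using S T by auto
  next
    fix \<K> assume K: "\<forall>K\<in>\<K>. ?L K"
    show "\<Union>\<K> \<subseteq> orbits G (topspace X) \<phi>" using K by blast
    have "{x \<in> topspace X. orbit G \<phi> x \<in> \<Union>\<K>} =
          \<Union>((\<lambda>K. {x \<in> topspace X. orbit G \<phi> x \<in> K}) ` \<K>)" by blast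
    then show "openin X {x \<in> topspace X. orbit G \<phi> x \<in> \<Union>\<K>}" using K by auto
  qed
  then show ?thesis by (simp add: orbit_space_def)
qed

lemma topspace_orbit_space: "topspace (orbit_space G X \<phi>) = orbits G (topspace X) \<phi>"
proof -
  have "{x \<in> topspace X. orbit G \<phi> x \<in> orbits G (topspace X) \<phi>} = topspace X"
    by (auto simp: orbits_def)
  then have "openin (orbit_space G X \<phi>) (orbits G (topspace X) \<phi>)"
    by (simp add: openin_orbit_space)
  then show ?thesis
    by (meson openin_orbit_space openin_subset openin_topspace subset_antisym)
qed

lemma quotient_map_orbit: "quotient_map X (orbit_space G X \<phi>) (orbit G \<phi>)"
  unfolding quotient_map_def topspace_orbit_space openin_orbit_space
  by (auto simp: orbits_def)

text \<open>Local triviality: the homeomorphism \<open>f\<close> goes from the preimage of \<open>U\<close> to the product of the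
  group with \<open>U\<close>, is equivariant for left translation on the group factor, and lies over \<open>U\<close>.\<close>

definition principal_action ::
  "('g, 'm) monoid_scheme \<Rightarrow> 'g topology \<Rightarrow> 'x topology \<Rightarrow> ('g \<Rightarrow> 'x \<Rightarrow> 'x) \<Rightarrow> bool" where
  "principal_action G T X \<phi> \<longleftrightarrow>
     (\<forall>b \<in> topspace (orbit_space G X \<phi>). \<exists>U f.
        openin (orbit_space G X \<phi>) U \<and> b \<in> U \<and>
        homeomorphic_map
          (subtopology X {x \<in> topspace X. orbit G \<phi> x \<in> U})
          (prod_topology T (subtopology (orbit_space G X \<phi>) U)) f \<and>
        (\<forall>x \<in> topspace X. orbit G \<phi> x \<in> U \<longrightarrow>
           snd (f x) = orbit G \<phi> x \<and>
           (\<forall>g \<in> carrier G. f (\<phi> g x) = (g \<otimes>\<^bsub>G\<^esub> fst (f x), snd (f x)))))"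

end

theory Submission
  imports Defs
begin

text \<open>A free action of a topological group \<open>G\<close> on \<open>X\<close> is principal iff every point has an
  open invariant neighbourhood with a continuous equivariant map to \<open>G\<close> (a chart). A closed
  subgroup \<open>H\<close> of finite index is open. Given an \<open>H\<close>-chart at \<open>x\<close> for a free \<open>G\<close>-action, compactness
  yields a smaller \<open>H\<close>-invariant neighbourhood whose translates by \<open>G - H\<close> miss it, and the
  chart then extends equivariantly to its \<open>G\<close>-saturation. Conversely, a free \<open>H\<close>-space \<open>X\<close>
  embeds in the induced \<open>G\<close>-space \<open>G \<times>\<^sub>H X\<close>, a sum of finitely many copies of \<open>X\<close>; a \<open>G\<close>-chart
  there restricts to a map \<open>X \<rightarrow> G\<close>, which a right translation turns into an \<open>H\<close>-chart on an
  open set. Since the theorem only speaks about spaces over a fixed type, the induced space has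
  to be copied back into that type: this is possible when \<open>X\<close> is infinite, and when \<open>X\<close> is finite
  it is discrete and the claim is immediate.\<close>

locale topgroup = group G for G (structure) +
  fixes T :: "'a topology"
  assumes topological_group: "topological_group G T"
begin

lemma topspace_eq: "topspace T = carrier G"
  using topological_group by (simp add: topological_group_def)

lemma continuous_map_mult:
  assumes "continuous_map Z T a" "continuous_map Z T b"
  shows "continuous_map Z T (\<lambda>z. a z \<otimes> b z)"
proof -
  have "continuous_map (prod_topology T T) T (\<lambda>(g, h). g \<otimes> h)"
    using topological_group by (simp add: topological_group_def)
  from continuous_map_compose[OF continuous_map_pairedI[OF assms] this]
  show ?thesis by (simp add: o_def)
qed

lemma continuous_map_inv:
  assumes "continuous_map Z T a"
  shows "continuous_map Z T (\<lambda>z. inv (a z))"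
proof -
  have "continuous_map T T (\<lambda>g. inv g)"
    using topological_group by (simp add: topological_group_def)
  from continuous_map_compose[OF assms this] show ?thesis by (simp add: o_def)
qed

lemma continuous_map_const_in: "g \<in> carrier G \<Longrightarrow> continuous_map Z T (\<lambda>z. g)"
  by (simp add: topspace_eq)

lemma topgroup_subgroup:
  assumes "subgroup H G"
  shows "topgroup (G\<lparr>carrier := H\<rparr>) (subtopology T H)"
proof -
  have "H \<subseteq> carrier G"
    using assms by (rule subgroup.subset)
  have *: "continuous_map (subtopology T H) T (\<lambda>g. g)"
    by (simp add: continuous_map_from_subtopology)
  have "continuous_map (prod_topology (subtopology T H) (subtopology T H)) T (\<lambda>z. fst z \<otimes> snd z)"
    by (intro continuous_map_mult)
      (meson continuous_map_fst continuous_map_snd continuous_map_into_fulltopology)+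
  moreover have "continuous_map (subtopology T H) T (\<lambda>g. inv g)"
    by (rule continuous_map_inv[OF *])
  then have "continuous_map (subtopology T H) T (\<lambda>g. inv\<^bsub>G\<lparr>carrier := H\<rparr>\<^esub> g)"
    by (rule continuous_map_eq) (simp add: assms topspace_eq)
  ultimately show ?thesis
    using assms \<open>H \<subseteq> carrier G\<close>
    unfolding topgroup_def topgroup_axioms_def topological_group_def
    by (auto simp: subgroup_imp_group continuous_map_in_subtopology topspace_eq case_prod_unfold
        subgroup.m_closed subgroup.m_inv_closed)
qed

lemma openin_finite_index_closed_subgroup:
  assumes H: "subgroup H G" and clo: "closedin T H" and fin: "finite (rcosets H)"
  shows "openin T H"
proof -
  have "closedin T C" if C: "C \<in> rcosets H" for C
  proof -
    obtain a where a: "a \<in> carrier G" "C = H #> a"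
      using C by (auto simp: RCOSETS_def)
    have "continuous_map T T (\<lambda>g. g \<otimes> inv a)"
      using a by (intro continuous_map_mult continuous_map_const_in) auto
    from closedin_continuous_map_preimage[OF this clo]
    have "closedin T {g \<in> carrier G. g \<otimes> inv a \<in> H}"
      by (simp add: topspace_eq)
    also have "{g \<in> carrier G. g \<otimes> inv a \<in> H} = C"
    proof (intro equalityI subsetI)
      fix g assume "g \<in> {g \<in> carrier G. g \<otimes> inv a \<in> H}"
      then have "g = (g \<otimes> inv a) \<otimes> a" "g \<otimes> inv a \<in> H"
        using a by (auto simp: m_assoc)
      then show "g \<in> C" unfolding a r_coset_def by blast
    next
      fix g assume "g \<in> C"
      then show "g \<in> {g \<in> carrier G. g \<otimes> inv a \<in> H}"
        using a subgroup.mem_carrier[OF H] by (auto simp: r_coset_def m_assoc)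
    qed
    finally show ?thesis .
  qed
  then have "closedin T (\<Union>(rcosets H - {H}))"
    using fin by (intro closedin_Union) auto
  moreover have "carrier G - \<Union>(rcosets H - {H}) = H"
  proof -
    have "H \<in> rcosets H" by (metis H coset_mult_one one_closed rcosetsI subgroup.subset)
    moreover have "disjnt C H" if "C \<in> rcosets H - {H}" for C
      using rcos_disjoint[OF H] that calculation by (auto simp: pairwise_def)
    ultimately show ?thesis
      using rcosets_part_G[OF H] by (auto simp: disjnt_iff)
  qed
  ultimately show ?thesis
    by (metis openin_diff openin_topspace topspace_eq)
qed

end

locale continuous_group_action = topgroup +
  fixes X :: "'x topology" and \<phi>
  assumes continuous_action: "continuous_action G T X \<phi>"

sublocale continuous_group_action \<subseteq> group_action G "topspace X" \<phi>
  using continuous_action by (simp add: continuous_action_def)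

context continuous_group_action
begin

lemma continuous_map_action:
  assumes "continuous_map Z T a" "continuous_map Z X b"
  shows "continuous_map Z X (\<lambda>z. \<phi> (a z) (b z))"
proof -
  have "continuous_map (prod_topology T X) X (\<lambda>(g, x). \<phi> g x)"
    using continuous_action by (simp add: continuous_action_def)
  from continuous_map_compose[OF continuous_map_pairedI[OF assms] this]
  show ?thesis by (simp add: o_def)
qed

lemma action_closed: "g \<in> carrier G \<Longrightarrow> x \<in> topspace X \<Longrightarrow> \<phi> g x \<in> topspace X"
  using element_image by blast

lemma action_one: "x \<in> topspace X \<Longrightarrow> \<phi> \<one> x = x"
  by (metis id_eq_one restrict_apply')

lemma action_mult:
  "g \<in> carrier G \<Longrightarrow> h \<in> carrier G \<Longrightarrow> x \<in> topspace X \<Longrightarrow> \<phi> g (\<phi> h x) = \<phi> (g \<otimes> h) x"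
  by (simp add: composition_rule)

lemma action_inv_cancel:
  assumes "g \<in> carrier G" "x \<in> topspace X"
  shows "\<phi> (inv g) (\<phi> g x) = x" "\<phi> g (\<phi> (inv g) x) = x"
  using assms by (simp_all add: action_mult action_one)

lemma orbit_action:
  assumes "g \<in> carrier G" "x \<in> topspace X"
  shows "orbit G \<phi> (\<phi> g x) = orbit G \<phi> x"
proof -
  have "\<exists>k\<in>carrier G. \<phi> h (\<phi> g x) = \<phi> k x" if "h \<in> carrier G" for h
    using assms that by (metis action_mult m_closed)
  moreover have "\<exists>k\<in>carrier G. \<phi> h x = \<phi> k (\<phi> g x)" if "h \<in> carrier G" for h
    using assms that
    by (intro bexI[of _ "h \<otimes> inv g"]) (simp_all add: action_mult m_assoc)
  ultimately show ?thesis unfolding orbit_def by blast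
qed

lemma orbit_eqD:
  assumes "orbit G \<phi> y = orbit G \<phi> x" "x \<in> topspace X" "y \<in> topspace X"
  obtains g where "g \<in> carrier G" "y = \<phi> g x"
  using assms orbit_refl[of y] by (auto simp: orbit_def)

lemma openin_forall_action:
  assumes C: "compactin T C" and W: "openin X W"
  shows "openin X {x \<in> topspace X. \<forall>g\<in>C. \<phi> g x \<in> W}"
proof -
  have cont: "continuous_map (prod_topology T X) X (\<lambda>z. \<phi> (fst z) (snd z))"
    by (intro continuous_map_action continuous_map_fst continuous_map_snd)
  let ?P = "{z \<in> topspace (prod_topology T X). \<phi> (fst z) (snd z) \<in> W}"
  have P: "openin (prod_topology T X) ?P"
    by (rule openin_continuous_map_preimage[OF cont W])
  have CT: "C \<subseteq> topspace T" using C by (rule compactin_subset_topspace)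
  show ?thesis
  proof (subst openin_subopen, intro ballI)
    fix x assume x: "x \<in> {x \<in> topspace X. \<forall>g\<in>C. \<phi> g x \<in> W}"
    then have "C \<times> {x} \<subseteq> ?P" using CT by auto
    moreover have "x \<in> topspace X" using x by simp
    ultimately obtain U V where "openin X V" "C \<subseteq> U" "x \<in> V" "U \<times> V \<subseteq> ?P"
      using tube_lemma_left[OF P C, of x] by auto
    moreover have "(g, y) \<in> ?P" if "g \<in> C" "y \<in> V" for g y
      using calculation that by blast
    then have "V \<subseteq> {x \<in> topspace X. \<forall>g\<in>C. \<phi> g x \<in> W}"
      using openin_subset[OF calculation(1)] by auto
    ultimately show "\<exists>V. openin X V \<and> x \<in> V \<and> V \<subseteq> {x \<in> topspace X. \<forall>g\<in>C. \<phi> g x \<in> W}"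
      by blast
  qed
qed

end

lemma continuous_actionI:
  assumes G: "group G"
    and clo: "\<And>g x. g \<in> carrier G \<Longrightarrow> x \<in> topspace X \<Longrightarrow> \<phi> g x \<in> topspace X"
    and ext: "\<And>g. g \<in> carrier G \<Longrightarrow> \<phi> g \<in> extensional (topspace X)"
    and one: "\<And>x. x \<in> topspace X \<Longrightarrow> \<phi> \<one>\<^bsub>G\<^esub> x = x"
    and mult: "\<And>g h x. g \<in> carrier G \<Longrightarrow> h \<in> carrier G \<Longrightarrow> x \<in> topspace X \<Longrightarrow>
                 \<phi> (g \<otimes>\<^bsub>G\<^esub> h) x = \<phi> g (\<phi> h x)"
    and cont: "continuous_map (prod_topology T X) X (\<lambda>z. \<phi> (fst z) (snd z))"
  shows "continuous_action G T X \<phi>"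
proof -
  interpret group G by (rule G)
  have bij: "\<phi> g \<in> Bij (topspace X)" if g: "g \<in> carrier G" for g
  proof -
    have "\<phi> (inv\<^bsub>G\<^esub> g) (\<phi> g x) = x" "\<phi> g (\<phi> (inv\<^bsub>G\<^esub> g) x) = x" if "x \<in> topspace X" for x
      using mult[of "inv\<^bsub>G\<^esub> g" g x, symmetric] mult[of g "inv\<^bsub>G\<^esub> g" x, symmetric] g that
      by (simp_all add: one)
    then have "bij_betw (\<phi> g) (topspace X) (topspace X)"
      using g clo by (intro bij_betw_byWitness[where f' = "\<phi> (inv\<^bsub>G\<^esub> g)"]) auto
    then show ?thesis using ext[OF g] by (simp add: Bij_def)
  qed
  have "\<phi> (g \<otimes>\<^bsub>G\<^esub> h) = compose (topspace X) (\<phi> g) (\<phi> h)"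
    if "g \<in> carrier G" "h \<in> carrier G" for g h
    by (rule extensionalityI[where A = "topspace X"])
      (use that in \<open>auto simp: ext mult compose_eq\<close>)
  then have "\<phi> \<in> hom G (BijGroup (topspace X))"
    using bij by (auto simp: hom_def BijGroup_def)
  then have "group_action G (topspace X) \<phi>"
    by (simp add: group_action_def group_hom_def group_hom_axioms_def G group_BijGroup)
  then show ?thesis
    using cont by (simp add: continuous_action_def case_prod_unfold)
qed

definition equivariant_chart ::
  "('g, 'm) monoid_scheme \<Rightarrow> 'g topology \<Rightarrow> 'x topology \<Rightarrow> ('g \<Rightarrow> 'x \<Rightarrow> 'x) \<Rightarrow>
    'x set \<Rightarrow> ('x \<Rightarrow> 'g) \<Rightarrow> bool" where
  "equivariant_chart G T X \<phi> V f \<longleftrightarrow>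
     openin X V \<and> continuous_map (subtopology X V) T f \<and>
     (\<forall>g\<in>carrier G. \<forall>x\<in>V. \<phi> g x \<in> V \<and> f (\<phi> g x) = g \<otimes>\<^bsub>G\<^esub> f x)"

context continuous_group_action
begin

lemma principal_imp_equivariant_chart:
  assumes P: "principal_action G T X \<phi>" and x: "x \<in> topspace X"
  shows "\<exists>V f. equivariant_chart G T X \<phi> V f \<and> x \<in> V"
proof -
  have "orbit G \<phi> x \<in> topspace (orbit_space G X \<phi>)"
    using x by (auto simp: topspace_orbit_space orbits_def)
  from bspec[OF P[unfolded principal_action_def] this]
  obtain U f where U: "openin (orbit_space G X \<phi>) U" "orbit G \<phi> x \<in> U"
    and f: "homeomorphic_map (subtopology X {x \<in> topspace X. orbit G \<phi> x \<in> U})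
        (prod_topology T (subtopology (orbit_space G X \<phi>) U)) f"
    and eq: "\<forall>x\<in>topspace X. orbit G \<phi> x \<in> U \<longrightarrow> snd (f x) = orbit G \<phi> x \<and>
          (\<forall>g\<in>carrier G. f (\<phi> g x) = (g \<otimes> fst (f x), snd (f x)))"
    by (elim exE conjE)
  let ?V = "{x \<in> topspace X. orbit G \<phi> x \<in> U}"
  have "openin X ?V" using U by (simp add: openin_orbit_space)
  moreover have "continuous_map (subtopology X ?V) T (fst \<circ> f)"
    using f homeomorphic_imp_continuous_map continuous_map_fst_of by blast
  ultimately have "equivariant_chart G T X \<phi> ?V (fst \<circ> f)"
    by (auto simp: equivariant_chart_def eq orbit_action action_closed)
  then show ?thesis using x U by blast
qed

lemma equivariant_charts_imp_principal:
  assumes charts: "\<And>x. x \<in> topspace X \<Longrightarrow> \<exists>V f. equivariant_chart G T X \<phi> V f \<and> x \<in> V"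
  shows "principal_action G T X \<phi>"
  unfolding principal_action_def
proof
  let ?B = "orbit_space G X \<phi>" and ?p = "orbit G \<phi>"
  fix b assume "b \<in> topspace ?B"
  then obtain x where x: "x \<in> topspace X" "b = ?p x"
    by (auto simp: topspace_orbit_space orbits_def)
  obtain V f where ch: "equivariant_chart G T X \<phi> V f" and xV: "x \<in> V"
    using charts x by blast
  have oV: "openin X V" and cf: "continuous_map (subtopology X V) T f"
    and inv: "\<And>g y. g \<in> carrier G \<Longrightarrow> y \<in> V \<Longrightarrow> \<phi> g y \<in> V"
    and eqf: "\<And>g y. g \<in> carrier G \<Longrightarrow> y \<in> V \<Longrightarrow> f (\<phi> g y) = g \<otimes> f y"
    using ch by (auto simp: equivariant_chart_def)
  have VX: "V \<subseteq> topspace X" using oV by (rule openin_subset)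
  have fG: "f y \<in> carrier G" if "y \<in> V" for y
    using continuous_map_image_subset_topspace[OF cf] that VX by (auto simp: topspace_eq)
  let ?U = "?p ` V"
  have pre: "{y \<in> topspace X. ?p y \<in> ?U} = V"
  proof -
    have "y \<in> V" if yv: "y \<in> topspace X" "v \<in> V" "?p y = ?p v" for y v
    proof -
      obtain g where "g \<in> carrier G" "y = \<phi> g v"
        using orbit_eqD[OF yv(3)] yv VX by blast
      then show ?thesis using inv yv by simp
    qed
    then show ?thesis using VX by auto
  qed
  have UB: "?U \<subseteq> topspace ?B"
    using VX by (auto simp: topspace_orbit_space orbits_def)
  have oU: "openin ?B ?U"
    using UB oV pre by (simp add: openin_orbit_space topspace_orbit_space)
  have quo: "quotient_map (subtopology X V) (subtopology ?B ?U) ?p"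
    by (rule quotient_map_restriction[OF quotient_map_orbit pre]) (simp add: oU)
  have ch: "continuous_map (subtopology X V) X (\<lambda>y. \<phi> (inv (f y)) y)"
    by (intro continuous_map_action continuous_map_inv cf) (simp add: continuous_map_from_subtopology)
  have const: "\<phi> (inv (f y)) y = \<phi> (inv (f z)) z"
    if yz: "y \<in> V" "z \<in> V" "?p y = ?p z" for y z
  proof -
    obtain g where g: "g \<in> carrier G" "y = \<phi> g z"
      using orbit_eqD[OF yz(3)] yz VX by blast
    then show ?thesis
      using yz VX fG[OF \<open>z \<in> V\<close>]
      by (auto simp: eqf action_mult subset_iff inv_mult_group m_assoc)
  qed
  obtain s where cs: "continuous_map (subtopology ?B ?U) X s"
    and s: "\<And>y. y \<in> V \<Longrightarrow> s (?p y) = \<phi> (inv (f y)) y"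
    using quotient_map_lift_exists[OF quo ch] const VX
    by (metis (no_types, lifting) inf.absorb2 topspace_subtopology)
  let ?f = "\<lambda>y. (f y, ?p y)" and ?k = "\<lambda>z. \<phi> (fst z) (s (snd z))"
  let ?P = "prod_topology T (subtopology ?B ?U)"
  have ts: "topspace (subtopology X V) = V" "topspace ?P = carrier G \<times> ?U"
    using VX UB by (auto simp: topspace_eq)
  have fk: "?k (g, ?p v) \<in> V \<and> ?f (?k (g, ?p v)) = (g, ?p v)" if "g \<in> carrier G" "v \<in> V" for g v
    using that fG[OF \<open>v \<in> V\<close>] VX
    by (auto simp: s inv eqf orbit_action action_closed subset_iff)
  have "homeomorphic_maps (subtopology X V) ?P ?f ?k"
    unfolding homeomorphic_maps_def
  proof (intro conjI ballI)
    show "continuous_map (subtopology X V) ?P ?f"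
      by (intro continuous_map_pairedI cf quotient_imp_continuous_map quo)
    have "continuous_map ?P X ?k"
      by (intro continuous_map_action continuous_map_fst
          continuous_map_compose[OF continuous_map_snd cs, unfolded o_def])
    then show "continuous_map ?P (subtopology X V) ?k"
      by (rule continuous_map_into_subtopology) (use fk ts in auto)
  next
    fix y assume "y \<in> topspace (subtopology X V)"
    then show "?k (?f y) = y"
      using fG VX by (auto simp: s action_inv_cancel)
  next
    fix z assume "z \<in> topspace ?P"
    then show "?f (?k z) = z" using fk unfolding ts by auto
  qed
  then have "homeomorphic_map (subtopology X {y \<in> topspace X. ?p y \<in> ?U}) ?P ?f"
    unfolding pre by (rule homeomorphic_maps_imp_map)
  moreover have "snd (?f y) = ?p y \<and> (\<forall>g\<in>carrier G. ?f (\<phi> g y) = (g \<otimes> fst (?f y), snd (?f y)))"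
    if "y \<in> topspace X" "?p y \<in> ?U" for y
  proof -
    have "y \<in> V" using that pre by blast
    then show ?thesis using that by (simp add: eqf orbit_action)
  qed
  ultimately show "\<exists>U f. openin ?B U \<and> b \<in> U \<and>
        homeomorphic_map (subtopology X {x \<in> topspace X. ?p x \<in> U})
          (prod_topology T (subtopology ?B U)) f \<and>
        (\<forall>x \<in> topspace X. ?p x \<in> U \<longrightarrow> snd (f x) = ?p x \<and>
           (\<forall>g \<in> carrier G. f (\<phi> g x) = (g \<otimes> fst (f x), snd (f x))))"
    using oU x xV by (intro exI[of _ ?U] exI[of _ ?f]) auto
qed

end

context continuous_group_action
begin

lemma continuous_group_action_subgroup:
  assumes H: "subgroup H G"
  shows "continuous_group_action (G\<lparr>carrier := H\<rparr>) (subtopology T H) X \<phi>"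
proof -
  have "continuous_map (prod_topology (subtopology T H) X) X (\<lambda>z. \<phi> (fst z) (snd z))"
    by (intro continuous_map_action)
      (meson continuous_map_fst continuous_map_snd continuous_map_into_fulltopology)+
  then have "continuous_action (G\<lparr>carrier := H\<rparr>) (subtopology T H) X \<phi>"
    by (intro continuous_actionI)
      (use subgroup.mem_carrier[OF H] H in
        \<open>auto simp: subgroup_imp_group action_closed action_one composition_rule
          intro: Bij_imp_extensional bij_prop0\<close>)
  then show ?thesis
    by (simp add: continuous_group_action_def continuous_group_action_axioms_def
        topgroup_subgroup[OF H])
qed

lemma free_action_iff:
  "free_action G X \<phi> \<longleftrightarrow> (\<forall>x\<in>topspace X. \<forall>g\<in>carrier G. \<phi> g x = x \<longrightarrow> g = \<one>)"
  unfolding free_action_def stabilizer_def using action_one by auto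

lemma free_action_subgroup:
  assumes "free_action G X \<phi>" "subgroup H G"
  shows "free_action (G\<lparr>carrier := H\<rparr>) X \<phi>"
proof -
  interpret sub: continuous_group_action "G\<lparr>carrier := H\<rparr>" "subtopology T H" X \<phi>
    by (rule continuous_group_action_subgroup[OF assms(2)])
  show ?thesis
    using assms subgroup.mem_carrier[OF assms(2)] by (auto simp: free_action_iff sub.free_action_iff)
qed

lemma separating_neighbourhood:
  assumes "compact_space T" "Hausdorff_space X" and free: "free_action G X \<phi>"
    and H: "subgroup H G" "openin T H" "closedin T H" and x: "x \<in> topspace X"
  shows "\<exists>N. openin X N \<and> x \<in> N \<and> (\<forall>h\<in>H. \<forall>y\<in>N. \<phi> h y \<in> N) \<and>
           (\<forall>k\<in>carrier G - H. \<forall>y\<in>N. \<phi> k y \<notin> N)"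
proof -
  let ?K = "carrier G - H"
  have HG: "H \<subseteq> carrier G" using H(1) by (rule subgroup.subset)
  have cH: "compactin T H"
    using assms by (intro closedin_compact_space)
  have "closedin T ?K"
    using H(2) by (metis closedin_diff closedin_topspace topspace_eq)
  then have cK: "compactin T ?K"
    using assms by (intro closedin_compact_space)
  have "continuous_map T X (\<lambda>g. \<phi> g x)"
    using x by (intro continuous_map_action) auto
  then have comp: "compactin X ((\<lambda>g. \<phi> g x) ` H)" "compactin X ((\<lambda>g. \<phi> g x) ` ?K)"
    using image_compactin cH cK by blast+
  have "\<phi> h x \<noteq> \<phi> k x" if hk: "h \<in> H" "k \<in> ?K" for h k
  proof
    assume eq: "\<phi> h x = \<phi> k x"
    have hG: "h \<in> carrier G" "k \<in> carrier G" using hk HG by auto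
    then have "\<phi> (inv h \<otimes> k) x = \<phi> (inv h) (\<phi> h x)"
      using x by (simp add: composition_rule eq)
    also have "\<dots> = x"
      using hG x by (simp add: action_inv_cancel)
    finally have "inv h \<otimes> k = \<one>"
      using free x hG by (simp add: free_action_iff)
    then have "k = h" using hG by (metis inv_closed inv_equality inv_inv)
    then show False using hk by simp
  qed
  then have "disjnt ((\<lambda>g. \<phi> g x) ` H) ((\<lambda>g. \<phi> g x) ` ?K)"
    by (auto simp: disjnt_iff)
  then obtain A B where AB: "openin X A" "openin X B" "(\<lambda>g. \<phi> g x) ` H \<subseteq> A"
      "(\<lambda>g. \<phi> g x) ` ?K \<subseteq> B" "disjnt A B"
    using Hausdorff_space_compact_separation[OF assms(2) comp] by metis
  let ?N = "{y \<in> topspace X. \<forall>h\<in>H. \<phi> h y \<in> A} \<inter> {y \<in> topspace X. \<forall>k\<in>?K. \<phi> k y \<in> B}"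
  have oneH: "\<one> \<in> H" using H(1) by (rule subgroup.one_closed)
  have "openin X ?N"
    using AB cH cK by (intro openin_Int openin_forall_action)
  moreover have "x \<in> ?N" using AB x by auto
  moreover have "\<phi> h y \<in> ?N" if "h \<in> H" "y \<in> ?N" for h y
  proof -
    have "h \<in> carrier G" using that HG by auto
    moreover have "g \<otimes> h \<in> H" if "g \<in> H" for g
      using that \<open>h \<in> H\<close> H(1) by (simp add: subgroup.m_closed)
    moreover have "k \<otimes> h \<in> ?K" if k: "k \<in> ?K" for k
    proof -
      have "k \<otimes> h \<in> H \<Longrightarrow> (k \<otimes> h) \<otimes> inv h \<in> H"
        using \<open>h \<in> H\<close> H(1) by (simp add: subgroup.m_closed subgroup.m_inv_closed)
      then show ?thesis using k \<open>h \<in> carrier G\<close> by (auto simp: m_assoc)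
    qed
    ultimately show ?thesis
      using that HG by (auto simp: action_mult action_closed subset_iff)
  qed
  moreover have "\<phi> k y \<notin> ?N" if "k \<in> ?K" "y \<in> ?N" for k y
  proof
    assume "\<phi> k y \<in> ?N"
    then have "\<phi> \<one> (\<phi> k y) \<in> A" using oneH by blast
    moreover have "\<phi> \<one> (\<phi> k y) = \<phi> k y"
      using that by (intro action_one action_closed) auto
    moreover have "\<phi> k y \<in> B" using that by blast
    ultimately show False using AB by (auto simp: disjnt_iff)
  qed
  ultimately show ?thesis by (intro exI[of _ ?N]) blast
qed

text \<open>A chart for \<open>H\<close> on a neighbourhood \<open>V\<close> whose translates by \<open>G - H\<close> miss \<open>V\<close>
  extends to \<open>GV\<close> by \<open>g v \<mapsto> g f(v)\<close>.\<close>

lemma extend_equivariant_chart: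
  assumes chart: "equivariant_chart (G\<lparr>carrier := H\<rparr>) (subtopology T H) X \<phi> V f"
    and H: "subgroup H G"
    and sep: "\<And>k y. k \<in> carrier G - H \<Longrightarrow> y \<in> V \<Longrightarrow> \<phi> k y \<notin> V"
    and x: "x \<in> V"
  shows "\<exists>V' F. equivariant_chart G T X \<phi> V' F \<and> x \<in> V'"
proof -
  have oV: "openin X V" and cf: "continuous_map (subtopology X V) (subtopology T H) f"
    and eqf: "\<And>h y. h \<in> H \<Longrightarrow> y \<in> V \<Longrightarrow> f (\<phi> h y) = h \<otimes> f y"
    using chart by (auto simp: equivariant_chart_def)
  have VX: "V \<subseteq> topspace X" using oV by (rule openin_subset)
  have fG: "f y \<in> carrier G" if "y \<in> V" for y
    using continuous_map_image_subset_topspace[OF cf] that VX by (auto simp: topspace_eq)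
  define W where "W g = {y \<in> topspace X. \<phi> (inv g) y \<in> V}" for g
  define V' where "V' = (\<Union>g\<in>carrier G. W g)"
  let ?F = "\<lambda>g y. g \<otimes> f (\<phi> (inv g) y)"
  have oW: "openin X (W g)" if "g \<in> carrier G" for g
    unfolding W_def
    by (rule openin_continuous_map_preimage[OF _ oV])
      (use that in \<open>intro continuous_map_action; simp add: topspace_eq\<close>)
  have V'X: "V' \<subseteq> topspace X" by (auto simp: V'_def W_def)
  have oV': "openin X V'" unfolding V'_def using oW by blast
  have consistent: "?F i y = ?F j y"
    if ij: "i \<in> carrier G" "j \<in> carrier G" "y \<in> W i" "y \<in> W j" for i j y
  proof -
    let ?h = "inv j \<otimes> i" and ?v = "\<phi> (inv i) y"
    have y: "y \<in> topspace X" "?v \<in> V" "\<phi> (inv j) y \<in> V" using ij by (auto simp: W_def)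
    have eq: "\<phi> ?h ?v = \<phi> (inv j) y"
      using ij y by (simp add: action_mult m_assoc)
    then have "?h \<in> H"
      using sep[of ?h ?v] ij y by auto
    then have "f (\<phi> (inv j) y) = ?h \<otimes> f ?v"
      using eqf[of ?h ?v] y eq by simp
    then show ?thesis
      using ij fG[OF y(2)] by (simp flip: m_assoc)
  qed
  obtain F where cF: "continuous_map (subtopology X V') T F"
    and F: "\<And>g y. g \<in> carrier G \<Longrightarrow> y \<in> W g \<Longrightarrow> F y = ?F g y"
  proof (rule pasting_lemma_exists[where X = "subtopology X V'" and I = "carrier G"
        and T = W and f = "\<lambda>g y. g \<otimes> f (\<phi> (inv g) y)" and Y = T])
    show "topspace (subtopology X V') \<subseteq> \<Union> (W ` carrier G)"
      by (auto simp: V'_def)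
    fix g assume g: "g \<in> carrier G"
    have WV': "W g \<subseteq> V'" using g by (auto simp: V'_def)
    then show "openin (subtopology X V') (W g)"
      using oW[OF g] by (simp add: openin_open_subtopology oV')
    have "continuous_map (subtopology X (W g)) X (\<lambda>y. \<phi> (inv g) y)"
      using g by (intro continuous_map_action) (simp_all add: topspace_eq continuous_map_from_subtopology)
    then have "continuous_map (subtopology X (W g)) (subtopology X V) (\<lambda>y. \<phi> (inv g) y)"
      by (rule continuous_map_into_subtopology) (auto simp: W_def)
    from continuous_map_compose[OF this continuous_map_into_fulltopology[OF cf]]
    have "continuous_map (subtopology X (W g)) T (\<lambda>y. f (\<phi> (inv g) y))"
      by (simp add: o_def)
    then have "continuous_map (subtopology X (W g)) T (\<lambda>y. g \<otimes> f (\<phi> (inv g) y))"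
      using g by (intro continuous_map_mult) (simp_all add: topspace_eq)
    then show "continuous_map (subtopology (subtopology X V') (W g)) T (\<lambda>y. g \<otimes> f (\<phi> (inv g) y))"
      using WV' by (simp add: subtopology_subtopology inf.absorb2)
  next
    fix i j y assume "i \<in> carrier G" "j \<in> carrier G" "y \<in> topspace (subtopology X V') \<inter> W i \<inter> W j"
    then show "?F i y = ?F j y" by (intro consistent) auto
  next
    fix F assume cF: "continuous_map (subtopology X V') T F"
      and *: "\<And>y g. g \<in> carrier G \<Longrightarrow> y \<in> topspace (subtopology X V') \<inter> W g \<Longrightarrow> F y = ?F g y"
    have "F y = ?F g y" if "g \<in> carrier G" "y \<in> W g" for g y
    proof (rule *)
      show "y \<in> topspace (subtopology X V') \<inter> W g"
        using that V'X by (auto simp: V'_def)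
    qed (rule that)
    then show thesis by (rule that[OF cF])
  qed
  have "\<phi> g y \<in> V' \<and> F (\<phi> g y) = g \<otimes> F y" if g: "g \<in> carrier G" and y: "y \<in> V'" for g y
  proof -
    obtain k where k: "k \<in> carrier G" "y \<in> W k" using y by (auto simp: V'_def)
    then have yX: "y \<in> topspace X" "\<phi> (inv k) y \<in> V" by (auto simp: W_def)
    have eq: "\<phi> (inv (g \<otimes> k)) (\<phi> g y) = \<phi> (inv k) y"
      using g k yX by (simp add: action_mult inv_mult_group m_assoc)
    then have W: "\<phi> g y \<in> W (g \<otimes> k)"
      using g yX by (simp add: W_def action_closed)
    then have "F (\<phi> g y) = g \<otimes> F y"
      using F[OF _ W] F[OF k] eq g k fG[OF yX(2)] by (simp add: m_assoc)
    then show ?thesis using W g k by (auto simp: V'_def)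
  qed
  then have "equivariant_chart G T X \<phi> V' F"
    using oV' cF by (simp add: equivariant_chart_def)
  moreover have "x \<in> V'"
    using x VX by (auto simp: V'_def W_def action_one intro!: bexI[of _ \<one>])
  ultimately show ?thesis by blast
qed

lemma principal_of_principal_subgroup:
  assumes "compact_space T" "Hausdorff_space X" "free_action G X \<phi>"
    and H: "subgroup H G" "openin T H" "closedin T H"
    and P: "principal_action (G\<lparr>carrier := H\<rparr>) (subtopology T H) X \<phi>"
  shows "principal_action G T X \<phi>"
proof (rule equivariant_charts_imp_principal)
  interpret sub: continuous_group_action "G\<lparr>carrier := H\<rparr>" "subtopology T H" X \<phi>
    by (rule continuous_group_action_subgroup[OF H(1)])
  fix x assume x: "x \<in> topspace X"
  obtain V f where V: "equivariant_chart (G\<lparr>carrier := H\<rparr>) (subtopology T H) X \<phi> V f" "x \<in> V"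
    using sub.principal_imp_equivariant_chart[OF P x] by blast
  obtain N where N: "openin X N" "x \<in> N" "\<forall>h\<in>H. \<forall>y\<in>N. \<phi> h y \<in> N"
      "\<forall>k\<in>carrier G - H. \<forall>y\<in>N. \<phi> k y \<notin> N"
    using separating_neighbourhood[OF assms(1-3) H x] by blast
  have "equivariant_chart (G\<lparr>carrier := H\<rparr>) (subtopology T H) X \<phi> (V \<inter> N) f"
    using V N
    by (auto simp: equivariant_chart_def intro: continuous_map_from_subtopology_mono)
  then show "\<exists>V f. equivariant_chart G T X \<phi> V f \<and> x \<in> V"
    by (rule extend_equivariant_chart[OF _ H(1)]) (use V N in auto)
qed

end

lemma (in group) ex_left_coset_representatives:
  assumes H: "subgroup H G" and fin: "finite (rcosets H)"
  obtains c where "finite (c ` carrier G)" "c \<one> = \<one>"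
    "\<And>g. g \<in> carrier G \<Longrightarrow> c g \<in> carrier G"
    "\<And>g. g \<in> carrier G \<Longrightarrow> inv (c g) \<otimes> g \<in> H"
    "\<And>g k. g \<in> carrier G \<Longrightarrow> k \<in> carrier G \<Longrightarrow> inv g \<otimes> k \<in> H \<Longrightarrow> c g = c k"
proof
  define e where "e C = (if C = H then \<one> else SOME y. y \<in> C)" for C
  let ?c = "\<lambda>g. inv (e (H #> inv g))"
  have HG: "H \<subseteq> carrier G" using H by (rule subgroup.subset)
  have "?c ` carrier G \<subseteq> (\<lambda>C. inv (e C)) ` (rcosets H)"
    using HG by (auto intro!: imageI rcosetsI)
  then show "finite (?c ` carrier G)"
    using fin finite_surj by blast
  show "?c \<one> = \<one>"
    using HG by (simp add: e_def)
  have e: "\<exists>h\<in>H. e (H #> inv g) = h \<otimes> inv g" if g: "g \<in> carrier G" for g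
  proof -
    have "e (H #> inv g) \<in> H #> inv g"
    proof (cases "H #> inv g = H")
      case True
      then show ?thesis by (simp add: e_def subgroup.one_closed[OF H])
    next
      case False
      have "inv g \<in> H #> inv g" using g H by (simp add: rcos_self)
      then show ?thesis using False by (auto simp: e_def intro: someI)
    qed
    then show ?thesis by (auto simp: r_coset_def)
  qed
  show "?c g \<in> carrier G" if "g \<in> carrier G" for g
    using e[OF that] that HG by auto
  show "inv (?c g) \<otimes> g \<in> H" if g: "g \<in> carrier G" for g
  proof -
    obtain h where h: "h \<in> H" "e (H #> inv g) = h \<otimes> inv g" using e[OF g] by blast
    then have "inv (?c g) \<otimes> g = h" using g HG by (auto simp: m_assoc)
    then show ?thesis using h by simp
  qed
  show "?c g = ?c k" if gk: "g \<in> carrier G" "k \<in> carrier G" "inv g \<otimes> k \<in> H" for g k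
  proof -
    have "inv (inv g \<otimes> k) \<in> H" using H gk by (simp add: subgroup.m_inv_closed)
    then have "inv k \<otimes> g \<in> H" using gk by (simp add: inv_mult_group)
    moreover have "inv k = (inv k \<otimes> g) \<otimes> inv g" using gk by (simp add: m_assoc)
    ultimately have "inv k \<in> H #> inv g" unfolding r_coset_def by blast
    then have "H #> inv g = H #> inv k"
      using gk H by (intro repr_independence) auto
    then show ?thesis by simp
  qed
qed

text \<open>With \<open>R\<close> a set of representatives of the left cosets, the induced space
  \<open>G \<times>\<^sub>H X\<close> is \<open>R \<times> X\<close>: writing \<open>g r = r' h\<close> with \<open>r' \<in> R\<close> and \<open>h \<in> H\<close>,
  the element \<open>g\<close> sends \<open>(r, x)\<close> to \<open>(r', h x)\<close>.\<close>

lemma (in topgroup) ex_induced_action: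
  assumes H: "subgroup H G" "openin T H" and fin: "finite (rcosets H)"
    and act: "free_continuous_action (G\<lparr>carrier := H\<rparr>) (subtopology T H) X \<phi>"
  obtains R \<psi> where "finite R" "\<one> \<in> R"
    "free_continuous_action G T (prod_topology (discrete_topology R) X) \<psi>"
    "\<And>h x. h \<in> H \<Longrightarrow> x \<in> topspace X \<Longrightarrow> \<psi> h (\<one>, x) = (\<one>, \<phi> h x)"
proof -
  interpret sub: continuous_group_action "G\<lparr>carrier := H\<rparr>" "subtopology T H" X \<phi>
    using act topgroup_subgroup[OF H(1)]
    by (simp add: continuous_group_action_def continuous_group_action_axioms_def
        free_continuous_action_def)
  have HG: "H \<subseteq> carrier G" using H(1) by (rule subgroup.subset)
  have free: "h = \<one>" if "h \<in> H" "x \<in> topspace X" "\<phi> h x = x" for h x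
    using act that by (auto simp: free_continuous_action_def sub.free_action_iff)
  obtain c where fR: "finite (c ` carrier G)" and c1: "c \<one> = \<one>"
    and cG: "\<And>g. g \<in> carrier G \<Longrightarrow> c g \<in> carrier G"
    and cH: "\<And>g. g \<in> carrier G \<Longrightarrow> inv (c g) \<otimes> g \<in> H"
    and c_cong: "\<And>g k. g \<in> carrier G \<Longrightarrow> k \<in> carrier G \<Longrightarrow> inv g \<otimes> k \<in> H \<Longrightarrow> c g = c k"
    using ex_left_coset_representatives[OF H(1) fin] by blast
  define R where "R = c ` carrier G"
  let ?D = "discrete_topology R"
  let ?Y = "prod_topology ?D X"
  let ?p = "\<lambda>g. inv (c g) \<otimes> g"
  define \<psi> where "\<psi> g = restrict (\<lambda>y. (c (g \<otimes> fst y), \<phi> (?p (g \<otimes> fst y)) (snd y))) (topspace ?Y)" for g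
  have RG: "R \<subseteq> carrier G" using cG by (auto simp: R_def)
  have cR: "c r = r" if "r \<in> R" for r
    using that c_cong[OF cG _ cH] by (auto simp: R_def)
  have c_c: "c (g \<otimes> c k) = c (g \<otimes> k)" if "g \<in> carrier G" "k \<in> carrier G" for g k
  proof (rule c_cong)
    have "inv (g \<otimes> c k) \<otimes> (g \<otimes> k) = inv (c k) \<otimes> (inv g \<otimes> (g \<otimes> k))"
      using that cG by (simp add: inv_mult_group m_assoc)
    also have "\<dots> = inv (c k) \<otimes> k"
      using that by (simp flip: m_assoc)
    finally show "inv (g \<otimes> c k) \<otimes> (g \<otimes> k) \<in> H" using cH[OF that(2)] by simp
  qed (use that cG in auto)
  have \<psi>: "\<psi> g (r, x) = (c (g \<otimes> r), \<phi> (?p (g \<otimes> r)) x)" if "r \<in> R" "x \<in> topspace X" for g r x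
    using that by (simp add: \<psi>_def)
  have clo: "\<phi> (?p g) x \<in> topspace X" if "g \<in> carrier G" "x \<in> topspace X" for g x
    using sub.action_closed[of "?p g" x] cH that by simp
  have oneH: "\<one> \<in> H" using H(1) by (rule subgroup.one_closed)
  have contc: "continuous_map T ?D c"
    unfolding continuous_map_def
  proof (intro conjI allI impI)
    fix U assume "openin ?D U"
    show "openin T {g \<in> topspace T. c g \<in> U}"
    proof (subst openin_subopen, intro ballI)
      fix g assume g: "g \<in> {g \<in> topspace T. c g \<in> U}"
      let ?N = "{k \<in> topspace T. inv g \<otimes> k \<in> H}"
      have "continuous_map T T (\<lambda>k. inv g \<otimes> k)"
        using g by (intro continuous_map_mult) (simp_all add: topspace_eq)
      then have "openin T ?N"
        using H(2) by (rule openin_continuous_map_preimage)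
      moreover have "g \<in> ?N" using g oneH by (simp add: topspace_eq)
      moreover have "?N \<subseteq> {g \<in> topspace T. c g \<in> U}"
        using g c_cong[of g] by (auto simp: topspace_eq)
      ultimately show "\<exists>N. openin T N \<and> g \<in> N \<and> N \<subseteq> {g \<in> topspace T. c g \<in> U}"
        by blast
    qed
  qed (auto simp: R_def topspace_eq)
  have "continuous_action G T ?Y \<psi>"
  proof (rule continuous_actionI)
    show "group G" by (rule group_axioms)
    show "\<psi> g y \<in> topspace ?Y" if "g \<in> carrier G" "y \<in> topspace ?Y" for g y
      using that RG clo[of "g \<otimes> fst y" "snd y"] by (auto simp: \<psi> R_def)
    show "\<psi> g \<in> extensional (topspace ?Y)" for g
      by (simp add: \<psi>_def)
    show "\<psi> \<one> y = y" if Y: "y \<in> topspace ?Y" for y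
    proof -
      obtain r x where y: "y = (r, x)" "r \<in> R" "x \<in> topspace X"
        using Y by auto
      then have "r \<in> carrier G" using RG by auto
      then show ?thesis
        using y sub.action_one[of x] by (simp add: \<psi> cR)
    qed
    show "\<psi> (g \<otimes> h) y = \<psi> g (\<psi> h y)"
      if gh: "g \<in> carrier G" "h \<in> carrier G" and Y: "y \<in> topspace ?Y" for g h y
    proof -
      obtain r x where y: "y = (r, x)" "r \<in> R" "x \<in> topspace X"
        using Y by auto
      then have r: "r \<in> carrier G" using RG by auto
      have hr: "c (h \<otimes> r) \<in> R" "h \<otimes> r \<in> carrier G" using gh r by (auto simp: R_def)
      let ?s = "c (h \<otimes> r)" and ?t = "c (g \<otimes> (h \<otimes> r))"
      have G: "?s \<in> carrier G" "?t \<in> carrier G" using gh r by (auto intro: cG)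
      have ts: "c (g \<otimes> ?s) = ?t" using gh r by (simp add: c_c)
      have inH: "?p (h \<otimes> r) \<in> H" "inv ?t \<otimes> (g \<otimes> ?s) \<in> H"
        using cH[OF hr(2)] cH[of "g \<otimes> ?s"] gh G by (auto simp: ts)
      have "?s \<otimes> (inv ?s \<otimes> (h \<otimes> r)) = h \<otimes> r"
        using G hr by (simp flip: m_assoc)
      then have eq: "(inv ?t \<otimes> (g \<otimes> ?s)) \<otimes> ?p (h \<otimes> r) = ?p (g \<otimes> (h \<otimes> r))"
        using G gh r by (simp add: m_assoc)
      have "\<psi> g (\<psi> h y) = (?t, \<phi> (inv ?t \<otimes> (g \<otimes> ?s)) (\<phi> (?p (h \<otimes> r)) x))"
        using y hr gh clo[of "h \<otimes> r" x] by (simp add: \<psi> ts)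
      also have "\<dots> = (?t, \<phi> (?p (g \<otimes> (h \<otimes> r))) x)"
        using sub.action_mult[of "inv ?t \<otimes> (g \<otimes> ?s)" "?p (h \<otimes> r)" x] inH y eq by simp
      also have "\<dots> = \<psi> (g \<otimes> h) y"
        using y gh r by (simp add: \<psi> m_assoc)
      finally show ?thesis by simp
    qed
    let ?Z = "prod_topology T ?Y"
    let ?m = "\<lambda>z. fst z \<otimes> fst (snd z)"
    have s: "continuous_map ?Z ?Y snd" by (rule continuous_map_snd)
    have sf: "continuous_map ?Z ?D (\<lambda>z. fst (snd z))" and ss: "continuous_map ?Z X (\<lambda>z. snd (snd z))"
      using continuous_map_fst_of[OF s] continuous_map_snd_of[OF s] by (simp_all add: o_def)
    have "continuous_map ?D T (\<lambda>r. r)" using RG by (auto simp: topspace_eq)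
    from continuous_map_compose[OF sf this]
    have m: "continuous_map ?Z T ?m"
      by (intro continuous_map_mult continuous_map_fst) (simp add: o_def)
    from continuous_map_compose[OF m contc]
    have cm: "continuous_map ?Z ?D (\<lambda>z. c (?m z))" by (simp add: o_def)
    have "continuous_map ?D T (\<lambda>r. r)" using RG by (auto simp: topspace_eq)
    from continuous_map_compose[OF cm this]
    have "continuous_map ?Z T (\<lambda>z. ?p (?m z))"
      by (intro continuous_map_mult continuous_map_inv m) (simp add: o_def)
    then have "continuous_map ?Z (subtopology T H) (\<lambda>z. ?p (?m z))"
      by (rule continuous_map_into_subtopology) (use RG in \<open>auto simp: topspace_eq intro!: cH\<close>)
    then have "continuous_map ?Z ?Y (\<lambda>z. (c (?m z), \<phi> (?p (?m z)) (snd (snd z))))"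
      by (intro continuous_map_pairedI cm sub.continuous_map_action ss)
    then show "continuous_map ?Z ?Y (\<lambda>z. \<psi> (fst z) (snd z))"
      by (rule continuous_map_eq) (auto simp: \<psi>)
  qed
  then interpret ind: continuous_group_action G T ?Y \<psi>
    by unfold_locales
  have "free_action G ?Y \<psi>"
    unfolding ind.free_action_iff
  proof (intro ballI impI)
    fix y g assume "y \<in> topspace ?Y" and g: "g \<in> carrier G" and eq: "\<psi> g y = y"
    then obtain r x where y: "y = (r, x)" "r \<in> R" "x \<in> topspace X" by auto
    then have r: "r \<in> carrier G" using RG by auto
    have cgr: "c (g \<otimes> r) = r"
      using eq y by (simp add: \<psi>)
    then have "\<phi> (inv r \<otimes> (g \<otimes> r)) x = x"
      using eq y by (simp add: \<psi>)
    moreover have "inv r \<otimes> (g \<otimes> r) \<in> H"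
      using cH[of "g \<otimes> r"] g r by (simp add: cgr)
    ultimately have "inv r \<otimes> (g \<otimes> r) = \<one>"
      using free y by metis
    then have "g \<otimes> r = r" using g r by (metis inv_closed inv_equality inv_inv m_closed)
    moreover have "g = (g \<otimes> r) \<otimes> inv r" using g r by (simp add: m_assoc)
    ultimately show "g = \<one>" using r by simp
  qed
  with ind.continuous_action have "free_continuous_action G T ?Y \<psi>"
    by (simp add: free_continuous_action_def)
  moreover have "\<one> \<in> R" using c1 by (force simp: R_def)
  moreover have "\<psi> h (\<one>, x) = (\<one>, \<phi> h x)" if "h \<in> H" "x \<in> topspace X" for h x
  proof -
    have h: "h \<in> carrier G" using that HG by auto
    have "c h = \<one>" using c_cong[of \<one> h] h c1 that by simp
    then show ?thesis using \<open>\<one> \<in> R\<close> h that by (simp add: \<psi>)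
  qed
  ultimately show thesis using that fR by (simp add: R_def)
qed

lemma (in continuous_group_action) free_continuous_action_transport:
  assumes free: "free_action G X \<phi>" and hom: "homeomorphic_maps X Z e k"
  shows "free_continuous_action G T Z (\<lambda>g. restrict (\<lambda>z. e (\<phi> g (k z))) (topspace Z))"
    (is "free_continuous_action G T Z ?\<psi>")
proof -
  have ce: "continuous_map X Z e" and ck: "continuous_map Z X k"
    and ke: "\<And>x. x \<in> topspace X \<Longrightarrow> k (e x) = x" and ek: "\<And>z. z \<in> topspace Z \<Longrightarrow> e (k z) = z"
    using hom by (auto simp: homeomorphic_maps_def)
  have e: "e x \<in> topspace Z" if "x \<in> topspace X" for x
    using ce that continuous_map_image_subset_topspace by blast
  have k: "k z \<in> topspace X" if "z \<in> topspace Z" for z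
    using ck that continuous_map_image_subset_topspace by blast
  have "continuous_map (prod_topology T Z) X (\<lambda>z. \<phi> (fst z) (k (snd z)))"
    using continuous_map_compose[OF continuous_map_snd ck]
    by (intro continuous_map_action continuous_map_fst) (simp add: o_def)
  from continuous_map_compose[OF this ce]
  have "continuous_map (prod_topology T Z) Z (\<lambda>z. ?\<psi> (fst z) (snd z))"
    by (rule continuous_map_eq) auto
  then have "continuous_action G T Z ?\<psi>"
    by (intro continuous_actionI)
      (auto simp: e k ek ke action_closed action_one composition_rule)
  then interpret tr: continuous_group_action G T Z ?\<psi>
    by unfold_locales
  have "free_action G Z ?\<psi>"
    unfolding tr.free_action_iff
  proof (intro ballI impI)
    fix z g assume z: "z \<in> topspace Z" and g: "g \<in> carrier G" and "?\<psi> g z = z"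
    then have "\<phi> g (k z) = k z"
      using ke[OF action_closed[OF g k[OF z]]] by simp
    then show "g = \<one>" using free g k[OF z] by (auto simp: free_action_iff)
  qed
  then show ?thesis using tr.continuous_action by (simp add: free_continuous_action_def)
qed

lemma (in topgroup) pullback_equivariant_chart:
  assumes H: "subgroup H G" "openin T H"
    and X: "\<And>h x. h \<in> H \<Longrightarrow> x \<in> topspace X \<Longrightarrow> \<phi> h x \<in> topspace X"
    and chart: "equivariant_chart G T Y \<psi> V F"
    and \<iota>: "continuous_map X Y \<iota>"
      "\<And>h x. h \<in> H \<Longrightarrow> x \<in> topspace X \<Longrightarrow> \<iota> (\<phi> h x) = \<psi> h (\<iota> x)"
    and x: "x \<in> topspace X" "\<iota> x \<in> V"
  shows "\<exists>V' f. equivariant_chart (G\<lparr>carrier := H\<rparr>) (subtopology T H) X \<phi> V' f \<and> x \<in> V'"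
proof -
  have oV: "openin Y V" and cF: "continuous_map (subtopology Y V) T F"
    and VF: "\<And>g y. g \<in> carrier G \<Longrightarrow> y \<in> V \<Longrightarrow> \<psi> g y \<in> V \<and> F (\<psi> g y) = g \<otimes> F y"
    using chart by (auto simp: equivariant_chart_def)
  have HG: "H \<subseteq> carrier G" using H(1) by (rule subgroup.subset)
  have FG: "F y \<in> carrier G" if "y \<in> V" for y
    using continuous_map_image_subset_topspace[OF cF] that openin_subset[OF oV]
    by (auto simp: topspace_eq)
  let ?f = "\<lambda>y. F (\<iota> y) \<otimes> inv (F (\<iota> x))"
  define W where "W = {y \<in> topspace X. \<iota> y \<in> V}"
  define V' where "V' = {y \<in> W. ?f y \<in> H}"
  have oW: "openin X W"
    unfolding W_def using \<iota>(1) oV by (rule openin_continuous_map_preimage)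
  have "continuous_map (subtopology X W) (subtopology Y V) \<iota>"
    by (rule continuous_map_into_subtopology[OF continuous_map_from_subtopology[OF \<iota>(1)]])
      (auto simp: W_def)
  from continuous_map_compose[OF this cF]
  have cf: "continuous_map (subtopology X W) T ?f"
    using x FG by (intro continuous_map_mult) (simp_all add: o_def topspace_eq)
  have "openin (subtopology X W) {y \<in> topspace (subtopology X W). ?f y \<in> H}"
    using cf H(2) by (rule openin_continuous_map_preimage)
  moreover have "{y \<in> topspace (subtopology X W). ?f y \<in> H} = V'"
    by (auto simp: V'_def W_def)
  ultimately have oV': "openin X V'" using oW by (simp add: openin_open_subtopology)
  have "continuous_map (subtopology X V') T ?f"
    using cf by (rule continuous_map_from_subtopology_mono) (auto simp: V'_def)
  then have "continuous_map (subtopology X V') (subtopology T H) ?f"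
    by (rule continuous_map_into_subtopology) (auto simp: V'_def)
  moreover have "\<phi> h y \<in> V' \<and> ?f (\<phi> h y) = h \<otimes> ?f y" if h: "h \<in> H" and y: "y \<in> V'" for h y
  proof -
    have hG: "h \<in> carrier G" and yV: "y \<in> topspace X" "\<iota> y \<in> V" "?f y \<in> H"
      using h y HG by (auto simp: V'_def W_def)
    have "?f (\<phi> h y) = h \<otimes> ?f y"
      using \<iota>(2)[OF h yV(1)] VF[OF hG yV(2)] FG[OF yV(2)] FG[OF x(2)] hG by (simp add: m_assoc)
    moreover from this have "?f (\<phi> h y) \<in> H" using h yV H(1) by (simp add: subgroup.m_closed)
    ultimately show ?thesis
      using \<iota>(2)[OF h yV(1)] VF[OF hG yV(2)] X[OF h yV(1)] by (simp add: V'_def W_def)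
  qed
  ultimately have "equivariant_chart (G\<lparr>carrier := H\<rparr>) (subtopology T H) X \<phi> V' ?f"
    using oV' by (simp add: equivariant_chart_def)
  moreover have "x \<in> V'"
    using x FG[OF x(2)] subgroup.one_closed[OF H(1)] by (simp add: V'_def W_def)
  ultimately show ?thesis by blast
qed

lemma (in continuous_group_action) principal_discrete:
  assumes free: "free_action G X \<phi>" and X: "X = discrete_topology (topspace X)"
  shows "principal_action G T X \<phi>"
proof (rule equivariant_charts_imp_principal)
  fix x assume x: "x \<in> topspace X"
  let ?V = "orbit G \<phi> x"
  have inj: "g = k" if gk: "g \<in> carrier G" "k \<in> carrier G" "\<phi> g x = \<phi> k x" for g k
  proof -
    have "\<phi> (inv k \<otimes> g) x = x"
      using gk x by (simp add: composition_rule action_inv_cancel)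
    then have "inv k \<otimes> g = \<one>"
      using free gk x by (simp add: free_action_iff)
    then show ?thesis using gk by (metis inv_closed inv_equality inv_inv)
  qed
  define f where "f y = (THE g. g \<in> carrier G \<and> y = \<phi> g x)" for y
  have f: "f (\<phi> g x) = g" if "g \<in> carrier G" for g
    unfolding f_def by (rule the_equality) (use that inj in auto)
  have VX: "?V \<subseteq> topspace X" using x by (auto simp: orbit_def action_closed)
  then have "openin X ?V" by (subst X) simp
  moreover have "continuous_map (subtopology X ?V) T f"
    by (subst X) (auto simp: topspace_eq orbit_def f)
  ultimately have "equivariant_chart G T X \<phi> ?V f"
    using x by (auto simp: equivariant_chart_def orbit_def action_mult f)
  then show "\<exists>V f. equivariant_chart G T X \<phi> V f \<and> x \<in> V"
    using orbit_refl[OF x] by blast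
qed

lemma ex_homeomorphic_maps_inj_on:
  assumes "inj_on j (topspace Y)"
  obtains Z k where "homeomorphic_maps Y Z j k"
proof
  let ?A = "j ` topspace Y" and ?k = "inv_into (topspace Y) j"
  let ?Z = "pullback_topology ?A ?k Y"
  have [simp]: "?k (j y) = y" if "y \<in> topspace Y" for y
    using assms that by simp
  have tZ: "topspace ?Z = ?A"
    by (auto simp: topspace_pullback_topology)
  have "{y \<in> topspace Y. j y \<in> ?k -` U \<inter> ?A} = U" if "openin Y U" for U
    using openin_subset[OF that] assms by (auto dest: inj_onD)
  then have "continuous_map Y ?Z j"
    by (auto simp: continuous_map_def tZ openin_pullback_topology)
  moreover have "continuous_map ?Z Y ?k"
    unfolding continuous_map_def
  proof (intro conjI allI impI)
    fix U assume "openin Y U"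
    then show "openin ?Z {z \<in> topspace ?Z. ?k z \<in> U}"
      unfolding openin_pullback_topology tZ by (intro exI[of _ U]) auto
  qed (auto simp: tZ)
  ultimately show "homeomorphic_maps Y ?Z j ?k"
    by (auto simp: homeomorphic_maps_def tZ)
qed

lemma ex_inj_on_finite_times_infinite:
  assumes "finite R" "infinite A"
  obtains j where "inj_on j (R \<times> A)" "j ` (R \<times> A) \<subseteq> A"
proof (cases "R = {}")
  case False
  obtain B where B: "B \<subseteq> A" "card B = card R" "finite B"
    using infinite_arbitrarily_large[OF assms(2)] by metis
  then obtain i where "inj_on i R" "i ` R \<subseteq> A"
    using finite_same_card_bij[OF assms(1) B(3)] by (auto simp: bij_betw_def)
  then have "\<exists>i. inj_on i R \<and> i ` R \<subseteq> A" by blast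
  then have "\<exists>j. inj_on j (R \<times> A) \<and> j ` (R \<times> A) \<subseteq> A"
    unfolding card_of_ordLeq
    using card_of_Times_infinite[OF assms(2) False] ordIso_imp_ordLeq by blast
  then show thesis using that by blast
qed (use that[of undefined] in simp)

lemma (in topgroup) principal_subgroup_of_principal:
  fixes X :: "'x topology"
  assumes H: "subgroup H G" "openin T H" and fin: "finite (rcosets H)"
    and act: "free_continuous_action (G\<lparr>carrier := H\<rparr>) (subtopology T H) X \<phi>"
    and haus: "Hausdorff_space X"
    and P: "\<And>R (Z :: 'x topology) \<psi>. finite R \<Longrightarrow> R \<noteq> {} \<Longrightarrow>
        prod_topology (discrete_topology (R :: 'a set)) X homeomorphic_space Z \<Longrightarrow>
        free_continuous_action G T Z \<psi> \<Longrightarrow> principal_action G T Z \<psi>"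
  shows "principal_action (G\<lparr>carrier := H\<rparr>) (subtopology T H) X \<phi>"
proof -
  interpret sub: continuous_group_action "G\<lparr>carrier := H\<rparr>" "subtopology T H" X \<phi>
    using act topgroup_subgroup[OF H(1)]
    by (simp add: continuous_group_action_def continuous_group_action_axioms_def
        free_continuous_action_def)
  show ?thesis
  proof (cases "finite (topspace X)")
    case True
    then have "X = discrete_topology (topspace X)"
      using haus by (intro finite_t1_space_imp_discrete_topology Hausdorff_imp_t1_space) auto
    then show ?thesis
      using act by (intro sub.principal_discrete) (simp add: free_continuous_action_def)
  next
    case False
    obtain R \<psi> where R: "finite R" "\<one> \<in> R"
      and ind: "free_continuous_action G T (prod_topology (discrete_topology R) X) \<psi>"
      and \<psi>: "\<And>h x. h \<in> H \<Longrightarrow> x \<in> topspace X \<Longrightarrow> \<psi> h (\<one>, x) = (\<one>, \<phi> h x)"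
      using ex_induced_action[OF H fin act] by blast
    let ?Y = "prod_topology (discrete_topology R) X"
    interpret ind: continuous_group_action G T ?Y \<psi>
      using ind by unfold_locales (simp add: free_continuous_action_def)
    obtain j :: "'a \<times> 'x \<Rightarrow> 'x" where "inj_on j (R \<times> topspace X)"
      by (rule ex_inj_on_finite_times_infinite[OF R(1) False])
    then have "inj_on j (topspace ?Y)" by simp
    then obtain Z k where hom: "homeomorphic_maps ?Y Z j k"
      by (rule ex_homeomorphic_maps_inj_on)
    define \<psi>' where "\<psi>' g = restrict (\<lambda>z. j (\<psi> g (k z))) (topspace Z)" for g
    have fc: "free_continuous_action G T Z \<psi>'"
      unfolding \<psi>'_def
      using ind.free_continuous_action_transport[OF _ hom] ind
      by (simp add: free_continuous_action_def)
    then interpret Z: continuous_group_action G T Z \<psi>'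
      by unfold_locales (simp add: free_continuous_action_def)
    have prin: "principal_action G T Z \<psi>'"
      using P[OF R(1) _ homeomorphic_maps_imp_homeomorphic_space[OF hom] fc] R by blast
    let ?\<iota> = "\<lambda>x. j (\<one>, x)"
    have "continuous_map X ?Y (\<lambda>x. (\<one>, x))"
      using R by (intro continuous_map_pairedI) auto
    from continuous_map_compose[OF this, of Z j] hom
    have \<iota>: "continuous_map X Z ?\<iota>"
      by (simp add: homeomorphic_maps_def o_def)
    have eq: "?\<iota> (\<phi> h x) = \<psi>' h (?\<iota> x)" if "h \<in> H" "x \<in> topspace X" for h x
    proof -
      have "?\<iota> x \<in> topspace Z" using \<iota> that continuous_map_image_subset_topspace by blast
      moreover have "k (?\<iota> x) = (\<one>, x)" using hom that R by (simp add: homeomorphic_maps_def)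
      ultimately show ?thesis using that by (simp add: \<psi>'_def \<psi>)
    qed
    show ?thesis
    proof (rule sub.equivariant_charts_imp_principal)
      fix x assume x: "x \<in> topspace X"
      then have "?\<iota> x \<in> topspace Z" using \<iota> continuous_map_image_subset_topspace by blast
      then obtain V F where "equivariant_chart G T Z \<psi>' V F" "?\<iota> x \<in> V"
        using Z.principal_imp_equivariant_chart[OF prin] by blast
      then show "\<exists>V f. equivariant_chart (G\<lparr>carrier := H\<rparr>) (subtopology T H) X \<phi> V f \<and> x \<in> V"
        using x eq sub.action_closed
        by (intro pullback_equivariant_chart[OF H _ _ \<iota>]) auto
    qed
  qed
qed

lemma principal_actions_finite_index_iff:
  fixes G :: "('g, 'm) monoid_scheme" and T :: "'g topology" and \<P> :: "'x topology \<Rightarrow> bool"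
  assumes G: "compact_group G T"
    and H: "subgroup H G" "closedin T H" "finite (rcosets\<^bsub>G\<^esub> H)"
    and haus: "\<And>X. \<P> X \<Longrightarrow> Hausdorff_space X"
    and sums: "\<And>(R :: 'g set) X Z. finite R \<Longrightarrow> R \<noteq> {} \<Longrightarrow> \<P> X \<Longrightarrow>
        prod_topology (discrete_topology R) X homeomorphic_space Z \<Longrightarrow> \<P> Z"
  shows "(\<forall>X \<phi>. \<P> X \<and> free_continuous_action (G\<lparr>carrier := H\<rparr>) (subtopology T H) X \<phi> \<longrightarrow>
             principal_action (G\<lparr>carrier := H\<rparr>) (subtopology T H) X \<phi>)
     \<longleftrightarrow> (\<forall>X \<phi>. \<P> X \<and> free_continuous_action G T X \<phi> \<longrightarrow> principal_action G T X \<phi>)"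
    (is "?L \<longleftrightarrow> ?R")
proof -
  have cT: "compact_space T" and tg: "topgroup G T"
    using G by (auto simp: compact_group_def topological_group_def topgroup_def topgroup_axioms_def)
  interpret topgroup G T by (rule tg)
  have oH: "openin T H"
    using H by (rule openin_finite_index_closed_subgroup)
  show ?thesis
  proof
    assume L: ?L
    show ?R
    proof (intro allI impI, elim conjE)
      fix X \<phi> assume X: "\<P> X" and act: "free_continuous_action G T X \<phi>"
      interpret continuous_group_action G T X \<phi>
        using act by unfold_locales (simp add: free_continuous_action_def)
      have free: "free_action G X \<phi>" using act by (simp add: free_continuous_action_def)
      have "free_continuous_action (G\<lparr>carrier := H\<rparr>) (subtopology T H) X \<phi>"
        using continuous_group_action.continuous_action[OF continuous_group_action_subgroup[OF H(1)]]
          free_action_subgroup[OF free H(1)]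
        by (simp add: free_continuous_action_def)
      then show "principal_action G T X \<phi>"
        using L X by (intro principal_of_principal_subgroup[OF cT haus[OF X] free H(1) oH H(2)]) blast
    qed
  next
    assume R: ?R
    show ?L
    proof (intro allI impI, elim conjE)
      fix X \<phi> assume X: "\<P> X"
        and "free_continuous_action (G\<lparr>carrier := H\<rparr>) (subtopology T H) X \<phi>"
      then show "principal_action (G\<lparr>carrier := H\<rparr>) (subtopology T H) X \<phi>"
        using R sums by (intro principal_subgroup_of_principal[OF H(1) oH H(3)] haus) blast+
    qed
  qed
qed

theorem lemma1p9:
  fixes G :: "('g, 'm) monoid_scheme" and T :: "'g topology" and H :: "'g set"
  assumes "compact_group G T"
    and "subgroup H G" and "closedin T H" and "finite (rcosets\<^bsub>G\<^esub> H)"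
  shows "((\<forall>(X :: 'x topology) \<phi>.
             tychonoff_space X \<and>
             free_continuous_action (G\<lparr>carrier := H\<rparr>) (subtopology T H) X \<phi> \<longrightarrow>
             principal_action (G\<lparr>carrier := H\<rparr>) (subtopology T H) X \<phi>)
          \<longleftrightarrow>
          (\<forall>(X :: 'x topology) \<phi>.
             tychonoff_space X \<and> free_continuous_action G T X \<phi> \<longrightarrow>
             principal_action G T X \<phi>))
       \<and> ((\<forall>(X :: 'x topology) \<phi>.
             compact_space X \<and> Hausdorff_space X \<and>
             free_continuous_action (G\<lparr>carrier := H\<rparr>) (subtopology T H) X \<phi> \<longrightarrow>
             principal_action (G\<lparr>carrier := H\<rparr>) (subtopology T H) X \<phi>)
          \<longleftrightarrow>
          (\<forall>(X :: 'x topology) \<phi>.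
             compact_space X \<and> Hausdorff_space X \<and> free_continuous_action G T X \<phi> \<longrightarrow>
             principal_action G T X \<phi>))"
proof
  have tych: "tychonoff_space Z"
    if "finite R" "R \<noteq> {}" and X: "tychonoff_space X"
      and hom: "prod_topology (discrete_topology R) X homeomorphic_space Z"
    for R :: "'g set" and X Z :: "'x topology"
    using X unfolding tychonoff_space_def
      homeomorphic_completely_regular_space[OF hom, symmetric]
      homeomorphic_Hausdorff_space[OF hom, symmetric]
    by (simp add: completely_regular_space_prod_topology completely_regular_space_discrete_topology
        Hausdorff_space_prod_topology)
  show "(\<forall>(X :: 'x topology) \<phi>.
             tychonoff_space X \<and>
             free_continuous_action (G\<lparr>carrier := H\<rparr>) (subtopology T H) X \<phi> \<longrightarrow>
             principal_action (G\<lparr>carrier := H\<rparr>) (subtopology T H) X \<phi>)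
          \<longleftrightarrow>
          (\<forall>(X :: 'x topology) \<phi>.
             tychonoff_space X \<and> free_continuous_action G T X \<phi> \<longrightarrow>
             principal_action G T X \<phi>)"
    by (rule principal_actions_finite_index_iff[OF assms _ tych]) (simp_all add: tychonoff_space_def)
  have comp: "compact_space Z \<and> Hausdorff_space Z"
    if R: "finite R" "R \<noteq> {}" and X: "compact_space X \<and> Hausdorff_space X"
      and hom: "prod_topology (discrete_topology R) X homeomorphic_space Z"
    for R :: "'g set" and X Z :: "'x topology"
    using X R unfolding homeomorphic_compact_space[OF hom, symmetric]
      homeomorphic_Hausdorff_space[OF hom, symmetric]
    by (simp add: compact_space_prod_topology compact_space_discrete_topology
        Hausdorff_space_prod_topology)
  show "(\<forall>(X :: 'x topology) \<phi>.
             compact_space X \<and> Hausdorff_space X \<and>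
             free_continuous_action (G\<lparr>carrier := H\<rparr>) (subtopology T H) X \<phi> \<longrightarrow>
             principal_action (G\<lparr>carrier := H\<rparr>) (subtopology T H) X \<phi>)
          \<longleftrightarrow>
          (\<forall>(X :: 'x topology) \<phi>.
             compact_space X \<and> Hausdorff_space X \<and> free_continuous_action G T X \<phi> \<longrightarrow>
             principal_action G T X \<phi>)"
    by (rule principal_actions_finite_index_iff[
          where \<P> = "\<lambda>X. compact_space X \<and> Hausdorff_space X",
          OF assms _ comp, unfolded conj_assoc]) simp_all
qed

end
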